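(* Let $\theta$ be an action of an inverse semigroup $S$ on a locally compact Hausdorff space $X$. Then the following are equivalent. (i) There exists a finite (resp. countable) family of pairs $\{(f_i,K_i)\}_{i\in I}$ such that $f_i\in E(S)$ and $K_i\subset X_{f_i}$ is compact for each $i\in I$, and $X_e\subset\bigcup_{i\in I,\,f_i\ge e}K_i$ for each $e\in E(S)$. (ii) $X^{\mathrm{KS}}$ is compact (resp. $\sigma$-compact).
   Context: An inverse semigroup is a semigroup $S$ in which every $s$ has a unique $s^*$ with $ss^*s=s$, $s^*ss^*=s^*$; $E(S)$ is its commutative subsemigroup of idempotents; $s\le t$ means $ts^*s=s$. An action $\theta$ of $S$ on a topological space $X$ is a semigroup homomorphism $s\mapsto\theta_s$ from $S$ to the inverse semigroup of partial bijections of $X$ (bijections between subsets, composed on the largest possible domain) such that, writing $X_e$ for the subset on which $\theta_e$ ($e\in E(S)$) is the identity (so $\theta_s$ is a bijection $X_{s^*s}\to X_{ss^*}$): each $X_e$ is open, each $\theta_s\colon X_{s^*s}\to X_{ss^*}$ is continuous, and $\bigcup_{e\in E(S)}X_e=X$. The space $X^{\mathrm{KS}}$: let $\widetilde{X_e}=X_e\sqcup\{\infty_e\}$ be the one-point compactification of $X_e$ (a point $\infty_e$ is added even when $X_e$ is compact). Let $\widetilde{X^{\mathrm{KS}}}$ be the set of $\tau\in\prod_{e\in E(S)}\widetilde{X_e}$ such that (1) if $e_1\le e_2$ and $\tau(e_1)\ne\infty_{e_1}$, then $\tau(e_2)=\tau(e_1)$; (2) if $\tau(e_1)\neq\infty_{e_1}$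 and $\tau(e_2)\neq\infty_{e_2}$, then $\tau(e_1e_2)\neq\infty_{e_1e_2}$; with the topology induced from the product topology. Set $X^{\mathrm{KS}}=\widetilde{X^{\mathrm{KS}}}\setminus\{\infty\}$, $\infty=(\infty_e)_{e\in E(S)}$. *)

theory Defs
  imports "HOL-Analysis.Analysis"
begin

class inverse_semigroup = semigroup_mult +
  assumes ex1_inverse: "\<exists>!t. s * t * s = s \<and> t * s * t = t"

definition star :: "'s::inverse_semigroup \<Rightarrow> 's" where
  "star s = (THE t. s * t * s = s \<and> t * s * t = t)"

definition idempotents :: "'s::inverse_semigroup set" where
  "idempotents = {e. e * e = e}"

definition natural_le :: "'s::inverse_semigroup \<Rightarrow> 's \<Rightarrow> bool" (infix "\<preceq>" 50) where
  "s \<preceq> t \<longleftrightarrow> t * star s * s = s"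

text \<open>Partial maps are functions into an option type, so composition on the largest possible
  domain is \<^const>\<open>map_comp\<close>.\<close>

definition partial_bijection :: "'x set \<Rightarrow> ('x \<rightharpoonup> 'x) \<Rightarrow> bool" where
  "partial_bijection A f \<longleftrightarrow> dom f \<subseteq> A \<and> ran f \<subseteq> A \<and> inj_on f (dom f)"

definition fixed_set :: "('s \<Rightarrow> 'x \<rightharpoonup> 'x) \<Rightarrow> 's \<Rightarrow> 'x set" where
  "fixed_set \<theta> e = {x. \<theta> e x = Some x}"

definition inverse_semigroup_action ::
    "'x topology \<Rightarrow> ('s::inverse_semigroup \<Rightarrow> 'x \<rightharpoonup> 'x) \<Rightarrow> bool" where
  "inverse_semigroup_action X \<theta> \<longleftrightarrow>
     (\<forall>s. partial_bijection (topspace X) (\<theta> s)) \<and>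
     (\<forall>s t. \<theta> (s * t) = \<theta> s \<circ>\<^sub>m \<theta> t) \<and>
     (\<forall>e\<in>idempotents. openin X (fixed_set \<theta> e)) \<and>
     (\<forall>s. continuous_map (subtopology X (fixed_set \<theta> (star s * s)))
                         (subtopology X (fixed_set \<theta> (s * star s)))
                         (\<lambda>x. the (\<theta> s x))) \<and>
     (\<Union>e\<in>idempotents. fixed_set \<theta> e) = topspace X"

text \<open>\<^const>\<open>Alexandroff_compactification\<close> always adds the point \<^const>\<open>None\<close>, which is
  isolated if the given space is compact; \<^const>\<open>None\<close> in coordinate \<open>e\<close> is the point at infinity
  of that coordinate.\<close>

definition KS_product ::
    "'x topology \<Rightarrow> ('s::inverse_semigroup \<Rightarrow> 'x \<rightharpoonup> 'x) \<Rightarrow> ('s \<Rightarrow> 'x option) topology" where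
  "KS_product X \<theta> =
     product_topology (\<lambda>e. Alexandroff_compactification (subtopology X (fixed_set \<theta> e))) idempotents"

definition KS_tilde ::
    "'x topology \<Rightarrow> ('s::inverse_semigroup \<Rightarrow> 'x \<rightharpoonup> 'x) \<Rightarrow> ('s \<Rightarrow> 'x option) set" where
  "KS_tilde X \<theta> = {\<tau> \<in> topspace (KS_product X \<theta>).
     (\<forall>e1\<in>idempotents. \<forall>e2\<in>idempotents.
        e1 \<preceq> e2 \<and> \<tau> e1 \<noteq> None \<longrightarrow> \<tau> e2 = \<tau> e1) \<and>
     (\<forall>e1\<in>idempotents. \<forall>e2\<in>idempotents.
        \<tau> e1 \<noteq> None \<and> \<tau> e2 \<noteq> None \<longrightarrow> \<tau> (e1 * e2) \<noteq> None)}"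

definition KS_infinity :: "'s::inverse_semigroup \<Rightarrow> 'x option" where
  "KS_infinity = (\<lambda>e\<in>idempotents. None)"

definition KS_space ::
    "'x topology \<Rightarrow> ('s::inverse_semigroup \<Rightarrow> 'x \<rightharpoonup> 'x) \<Rightarrow> ('s \<Rightarrow> 'x option) topology" where
  "KS_space X \<theta> = subtopology (KS_product X \<theta>) (KS_tilde X \<theta> - {KS_infinity})"

definition sigma_compact_space :: "'a topology \<Rightarrow> bool" where
  "sigma_compact_space X \<longleftrightarrow>
     (\<exists>\<K>. countable \<K> \<and> (\<forall>K\<in>\<K>. compactin X K) \<and> \<Union>\<K> = topspace X)"

definition covering_family ::
    "'x topology \<Rightarrow> ('s::inverse_semigroup \<Rightarrow> 'x \<rightharpoonup> 'x) \<Rightarrow> ('s \<times> 'x set) set \<Rightarrow> bool" where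
  "covering_family X \<theta> F \<longleftrightarrow>
     (\<forall>(f, K)\<in>F. f \<in> idempotents \<and> K \<subseteq> fixed_set \<theta> f \<and> compactin X K) \<and>
     (\<forall>e\<in>idempotents. fixed_set \<theta> e \<subseteq> \<Union>{K. \<exists>f. (f, K) \<in> F \<and> e \<preceq> f})"

end

theory Submission
  imports Defs
begin

text \<open>
  For an idempotent \<open>f\<close> and a compact set \<open>K\<close> contained in the open set \<open>X_f\<close> fixed by \<open>f\<close>, consider
  the ``box'' of all \<open>\<tau>\<close> in \<open>X\<^sup>K\<^sup>S\<close> with \<open>\<tau> f \<in> K\<close>. Everything follows from three facts about
  boxes.

  Each box is compact (\<open>compactin_KS_box\<close>). The conditions that cut \<open>\<tau>\<close> out of the compact Hausdorff
  product of the one-point compactifications form a closed set (\<open>closedin_KS_tilde\<close>), and so does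
  \<open>\<tau> f \<in> K\<close>; and a box misses the point \<open>\<infinity>\<close>.

  Each compact subset of \<open>X\<^sup>K\<^sup>S\<close> lies in finitely many boxes (\<open>compact_covered_by_boxes\<close>): every
  \<open>\<tau> \<noteq> \<infinity>\<close> has some finite coordinate \<open>\<tau> f\<close>, which by local compactness has a neighbourhood
  inside some compact \<open>K \<subseteq> X_f\<close>, and this makes the box of \<open>(f, K)\<close> a neighbourhood of \<open>\<tau>\<close>.

  A family of pairs \<open>(f, K)\<close> satisfies the covering condition if and only if its boxes cover
  \<open>X\<^sup>K\<^sup>S\<close> (\<open>covering_family_iff\<close>). The link between a point \<open>x \<in> X_e\<close> and points of
  \<open>X\<^sup>K\<^sup>S\<close> is the principal point at \<open>(e, x)\<close>, which equals \<open>x\<close> on the idempotents above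
  \<open>e\<close> and is infinite elsewhere: it lies in the box of \<open>(f, K)\<close> exactly when \<open>e \<preceq> f\<close> and \<open>x \<in> K\<close>.

  Finite families of boxes thus correspond to compactness, and countable ones to
  \<open>\<sigma>\<close>-compactness.
\<close>

section \<open>Idempotents of an inverse semigroup\<close>

lemma star_eqI:
  assumes "s * t * s = s" "t * s * t = t"
  shows "star s = t"
  unfolding star_def using assms ex1_inverse[of s] by (intro the1_equality) auto

lemma star_inverse: "s * star s * s = s" "star s * s * star s = star s"
  using theI'[OF ex1_inverse[of s]] unfolding star_def by auto

lemma idempotent_absorb: "e \<in> idempotents \<Longrightarrow> e * (e * s) = e * s"
  by (metis (mono_tags) idempotents_def mem_Collect_eq mult.assoc)

lemma star_idempotent: "e \<in> idempotents \<Longrightarrow> star e = e"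
  by (rule star_eqI) (simp_all add: idempotents_def)

lemma natural_le_iff: "e \<in> idempotents \<Longrightarrow> e \<preceq> f \<longleftrightarrow> f * e = e"
  by (simp add: natural_le_def star_idempotent mult.assoc) (simp add: idempotents_def)

text \<open>Sandwiching the inverse \<open>x\<close> of \<open>e * f\<close> as \<open>f * x * e\<close> gives another inverse of
  \<open>e * f\<close>, hence \<open>x\<close> itself; in this form \<open>x\<close> is visibly idempotent. Hence \<open>x\<close> is its own inverse;
  but \<open>e * f\<close> is also an inverse of \<open>x\<close>, so \<open>x = e * f\<close>.\<close>

lemma idempotents_mult_closed:
  assumes e: "e \<in> idempotents" and f: "f \<in> idempotents"
  shows "e * f \<in> idempotents"
proof -
  define x where "x = star (e * f)"
  have inv: "e * (f * (x * (e * f))) = e * f" "x * (e * (f * x)) = x"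
    using star_inverse[of "e * f"] by (simp_all add: x_def mult.assoc)
  have inv': "x * (e * (f * (x * s))) = x * s" for s
    using arg_cong[OF inv(2), of "\<lambda>y. y * s"] by (simp add: mult.assoc)
  have x: "x = f * x * e"
    unfolding x_def
    by (rule star_eqI; simp only: x_def[symmetric] mult.assoc
        idempotent_absorb[OF e] idempotent_absorb[OF f] inv inv')
  have "x * x = f * x * e * (f * x * e)"
    by (rule arg_cong2[OF x x])
  also have "\<dots> = f * x * e"
    by (simp only: mult.assoc inv')
  also have "\<dots> = x"
    by (rule x[symmetric])
  finally have "x \<in> idempotents"
    by (simp add: idempotents_def)
  moreover have "star x = e * f"
    by (rule star_eqI) (simp_all add: mult.assoc inv)
  ultimately show ?thesis
    by (simp add: star_idempotent)
qed

text \<open>Since \<open>e * f\<close> and \<open>f * e\<close> are idempotent, \<open>f * e\<close> is an inverse of \<open>e * f\<close>; but so is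
  \<open>e * f\<close>.\<close>

lemma idempotents_commute:
  assumes e: "e \<in> idempotents" and f: "f \<in> idempotents"
  shows "e * f = f * e"
proof -
  have "e * (f * (e * f)) = e * f" "f * (e * (f * e)) = f * e"
    using idempotents_mult_closed[OF e f] idempotents_mult_closed[OF f e]
    by (simp_all add: idempotents_def mult.assoc)
  then have "star (e * f) = f * e"
    by (intro star_eqI; simp only: mult.assoc idempotent_absorb[OF e] idempotent_absorb[OF f])
  then show ?thesis
    by (simp add: star_idempotent idempotents_mult_closed e f)
qed

lemma natural_le_refl: "e \<in> idempotents \<Longrightarrow> e \<preceq> e"
  by (simp add: natural_le_iff) (simp add: idempotents_def)

lemma natural_le_trans:
  assumes "d \<in> idempotents" "e \<in> idempotents" "d \<preceq> e" "e \<preceq> f"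
  shows "d \<preceq> f"
  using assms by (metis mult.assoc natural_le_iff)

lemma mult_natural_le1:
  "e \<in> idempotents \<Longrightarrow> f \<in> idempotents \<Longrightarrow> e * f \<preceq> e"
  by (simp add: natural_le_iff idempotents_mult_closed idempotent_absorb)

lemma mult_natural_le2:
  "e \<in> idempotents \<Longrightarrow> f \<in> idempotents \<Longrightarrow> e * f \<preceq> f"
  using mult_natural_le1[of f e] by (simp add: idempotents_commute)

lemma natural_le_mult:
  assumes "d \<in> idempotents" "d \<preceq> e" "d \<preceq> f"
  shows "d \<preceq> e * f"
  using assms by (simp add: natural_le_iff mult.assoc)

section \<open>Closed conditions in products of one-point compactifications\<close>

lemma openin_disagree:
  assumes "Hausdorff_space Y" "openin P U"
    and "continuous_map (subtopology P U) Y f" "continuous_map (subtopology P U) Y g"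
  shows "openin P {p \<in> U. f p \<noteq> g p}"
proof -
  let ?D = "{p \<in> topspace (subtopology P U). f p = g p}"
  have "closedin (subtopology P U) ?D"
    using assms closedin_continuous_maps_eq by blast
  then have "openin (subtopology P U) (topspace (subtopology P U) - ?D)"
    by blast
  moreover have "topspace (subtopology P U) - ?D = {p \<in> U. f p \<noteq> g p}"
    using openin_subset[OF \<open>openin P U\<close>] by auto
  ultimately show ?thesis
    using \<open>openin P U\<close> openin_trans_full by fastforce
qed

lemma continuous_map_the:
  "continuous_map (subtopology (Alexandroff_compactification X) (Some ` topspace X)) X the"
proof -
  have "openin (subtopology (Alexandroff_compactification X) (Some ` topspace X))
          {z \<in> Some ` topspace X. the z \<in> U}" if "openin X U" for U
  proof -
    have "{z \<in> Some ` topspace X. the z \<in> U} = Some ` U"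
      using openin_subset[OF that] by auto
    then show ?thesis
      using that openin_subset[OF that]
      by (metis (no_types, lifting) image_mono inf.absorb_iff2 inf_commute
          openin_Alexandroff_compactification_image_Some openin_subtopology)
  qed
  then show ?thesis
    by (auto simp: continuous_map_def)
qed

section \<open>The ambient product and its closed subset\<close>

locale locally_compact_action =
  fixes X :: "'x topology" and \<theta> :: "'s::inverse_semigroup \<Rightarrow> 'x \<rightharpoonup> 'x"
  assumes locally_compact: "locally_compact_space X"
    and Hausdorff: "Hausdorff_space X"
    and action: "inverse_semigroup_action X \<theta>"
begin

lemma openin_fixed_set: "e \<in> idempotents \<Longrightarrow> openin X (fixed_set \<theta> e)"
  using action by (simp add: inverse_semigroup_action_def)

lemma topspace_fixed_set:
  "e \<in> idempotents \<Longrightarrow> topspace (subtopology X (fixed_set \<theta> e)) = fixed_set \<theta> e"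
  using openin_fixed_set openin_subset by fastforce

lemma \<theta>_mult: "\<theta> (s * t) = \<theta> s \<circ>\<^sub>m \<theta> t"
  using action by (simp add: inverse_semigroup_action_def)

lemma fixed_set_mono:
  assumes "e \<in> idempotents" "e \<preceq> f"
  shows "fixed_set \<theta> e \<subseteq> fixed_set \<theta> f"
proof
  fix x
  assume x: "x \<in> fixed_set \<theta> e"
  have "\<theta> e = \<theta> f \<circ>\<^sub>m \<theta> e"
    using assms \<theta>_mult[of f e] by (simp add: natural_le_iff)
  then have "\<theta> e x = (\<theta> f \<circ>\<^sub>m \<theta> e) x"
    by (rule fun_cong)
  moreover have "\<theta> e x = Some x"
    using x by (simp add: fixed_set_def)
  ultimately show "x \<in> fixed_set \<theta> f"
    by (simp add: fixed_set_def)
qed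

lemma fixed_set_mult: "fixed_set \<theta> e \<inter> fixed_set \<theta> f \<subseteq> fixed_set \<theta> (e * f)"
  by (auto simp: fixed_set_def \<theta>_mult)

lemma compact_space_KS_product: "compact_space (KS_product X \<theta>)"
  by (simp add: KS_product_def compact_space_product_topology)

lemma Hausdorff_compactified_fixed_set:
  "e \<in> idempotents \<Longrightarrow>
    Hausdorff_space (Alexandroff_compactification (subtopology X (fixed_set \<theta> e)))"
  by (simp add: Hausdorff_space_Alexandroff_compactification Hausdorff Hausdorff_space_subtopology
      locally_compact locally_compact_space_open_subset openin_fixed_set)

lemma continuous_coordinate:
  "e \<in> idempotents \<Longrightarrow>
    continuous_map (KS_product X \<theta>) (Alexandroff_compactification (subtopology X (fixed_set \<theta> e)))
      (\<lambda>\<tau>. \<tau> e)"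
  unfolding KS_product_def by (rule continuous_map_product_projection)

lemma coordinate_in_fixed_set:
  assumes "\<tau> \<in> topspace (KS_product X \<theta>)" "e \<in> idempotents" "\<tau> e = Some x"
  shows "x \<in> fixed_set \<theta> e"
proof -
  have "\<tau> e \<in> topspace (Alexandroff_compactification (subtopology X (fixed_set \<theta> e)))"
    using continuous_coordinate[OF assms(2)] assms(1) by (auto simp: continuous_map_def)
  then show ?thesis
    using assms by auto
qed

lemma openin_coordinate:
  assumes "e \<in> idempotents" "openin X U" "U \<subseteq> fixed_set \<theta> e"
  shows "openin (KS_product X \<theta>) {\<tau> \<in> topspace (KS_product X \<theta>). \<tau> e \<in> Some ` U}"
proof -
  have "openin (Alexandroff_compactification (subtopology X (fixed_set \<theta> e))) (Some ` U)"
    using assms openin_fixed_set by (simp add: openin_open_subtopology)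
  then show ?thesis
    by (rule openin_continuous_map_preimage[OF continuous_coordinate[OF assms(1)]])
qed

lemma continuous_the_coordinate:
  assumes "e \<in> idempotents" "U \<subseteq> {\<tau> \<in> topspace (KS_product X \<theta>). \<tau> e \<noteq> None}"
  shows "continuous_map (subtopology (KS_product X \<theta>) U) X (\<lambda>\<tau>. the (\<tau> e))"
proof -
  let ?Xe = "subtopology X (fixed_set \<theta> e)"
  have "\<tau> e \<in> Some ` topspace ?Xe" if "\<tau> \<in> U" for \<tau>
    using that assms coordinate_in_fixed_set[of \<tau> e] topspace_fixed_set[OF assms(1)] by force
  then have "continuous_map (subtopology (KS_product X \<theta>) U)
      (subtopology (Alexandroff_compactification ?Xe) (Some ` topspace ?Xe)) (\<lambda>\<tau>. \<tau> e)"
    by (intro continuous_map_into_subtopology continuous_map_from_subtopology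
        continuous_coordinate assms(1)) auto
  from continuous_map_compose[OF this continuous_map_the]
  show ?thesis
    by (simp add: o_def continuous_map_in_subtopology)
qed

text \<open>Where \<open>\<tau> e\<close> is a point of \<open>X_e \<inter> X_f\<close>, both \<open>\<tau> e\<close> and \<open>\<tau> f\<close> depend continuously on \<open>\<tau>\<close> as
  elements of the compactification of \<open>X_f\<close>, which is Hausdorff because \<open>X_f\<close> is open in \<open>X\<close>.\<close>

lemma openin_coordinate_mismatch:
  assumes e: "e \<in> idempotents" and f: "f \<in> idempotents"
  shows "openin (KS_product X \<theta>)
    {\<tau> \<in> topspace (KS_product X \<theta>). \<tau> e \<in> Some ` (fixed_set \<theta> e \<inter> fixed_set \<theta> f) \<and> \<tau> f \<noteq> \<tau> e}"
    (is "openin ?P _")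
proof -
  let ?Xf = "subtopology X (fixed_set \<theta> f)"
  define U where
    "U = {\<tau> \<in> topspace ?P. \<tau> e \<in> Some ` (fixed_set \<theta> e \<inter> fixed_set \<theta> f)}"
  have openU: "openin ?P U"
    unfolding U_def by (rule openin_coordinate) (use e f openin_fixed_set in auto)
  have "continuous_map (subtopology ?P U) X (\<lambda>\<tau>. the (\<tau> e))"
    by (rule continuous_the_coordinate[OF e]) (auto simp: U_def)
  then have "continuous_map (subtopology ?P U) ?Xf (\<lambda>\<tau>. the (\<tau> e))"
    by (rule continuous_map_into_subtopology) (auto simp: U_def)
  from continuous_map_compose[OF this continuous_map_Some]
  have "continuous_map (subtopology ?P U) (Alexandroff_compactification ?Xf)
      (\<lambda>\<tau>. Some (the (\<tau> e)))"
    by (simp add: o_def)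
  then have "continuous_map (subtopology ?P U) (Alexandroff_compactification ?Xf) (\<lambda>\<tau>. \<tau> e)"
    by (rule continuous_map_eq) (auto simp: U_def)
  moreover
  have "continuous_map (subtopology ?P U) (Alexandroff_compactification ?Xf) (\<lambda>\<tau>. \<tau> f)"
    by (simp add: continuous_coordinate continuous_map_from_subtopology f)
  ultimately have "openin ?P {\<tau> \<in> U. \<tau> f \<noteq> \<tau> e}"
    by (intro openin_disagree[OF Hausdorff_compactified_fixed_set[OF f] openU])
  moreover have "{\<tau> \<in> U. \<tau> f \<noteq> \<tau> e} = {\<tau> \<in> topspace ?P.
      \<tau> e \<in> Some ` (fixed_set \<theta> e \<inter> fixed_set \<theta> f) \<and> \<tau> f \<noteq> \<tau> e}"
    by (auto simp: U_def)
  ultimately show ?thesis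
    by simp
qed

lemma openin_finite_coordinate:
  assumes e: "e \<in> idempotents"
  shows "openin (KS_product X \<theta>) {\<tau> \<in> topspace (KS_product X \<theta>). \<tau> e \<noteq> None}"
proof -
  have "{\<tau> \<in> topspace (KS_product X \<theta>). \<tau> e \<noteq> None} =
      {\<tau> \<in> topspace (KS_product X \<theta>). \<tau> e \<in> Some ` fixed_set \<theta> e}"
    using coordinate_in_fixed_set[OF _ e] by auto
  then show ?thesis
    by (simp add: openin_coordinate openin_fixed_set e)
qed

lemma openin_finite_coordinates_clash:
  assumes e: "e \<in> idempotents" and f: "f \<in> idempotents"
  shows "openin (KS_product X \<theta>)
    {\<tau> \<in> topspace (KS_product X \<theta>). \<tau> e \<noteq> None \<and> \<tau> f \<noteq> None \<and> \<tau> e \<noteq> \<tau> f}"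
    (is "openin ?P _")
proof -
  define U where "U = {\<tau> \<in> topspace ?P. \<tau> e \<noteq> None} \<inter> {\<tau> \<in> topspace ?P. \<tau> f \<noteq> None}"
  have "openin ?P U"
    unfolding U_def by (intro openin_Int openin_finite_coordinate e f)
  moreover have "continuous_map (subtopology ?P U) X (\<lambda>\<tau>. the (\<tau> e))"
    "continuous_map (subtopology ?P U) X (\<lambda>\<tau>. the (\<tau> f))"
    by (intro continuous_the_coordinate e f; auto simp: U_def)+
  ultimately have "openin ?P {\<tau> \<in> U. the (\<tau> e) \<noteq> the (\<tau> f)}"
    by (intro openin_disagree[OF Hausdorff])
  moreover have "{\<tau> \<in> U. the (\<tau> e) \<noteq> the (\<tau> f)} =
      {\<tau> \<in> topspace ?P. \<tau> e \<noteq> None \<and> \<tau> f \<noteq> None \<and> \<tau> e \<noteq> \<tau> f}"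
    by (auto simp: U_def)
  ultimately show ?thesis
    by simp
qed

lemma KS_tildeD:
  assumes "\<tau> \<in> KS_tilde X \<theta>"
  shows "\<tau> \<in> topspace (KS_product X \<theta>)"
    and "\<lbrakk>e \<in> idempotents; f \<in> idempotents; e \<preceq> f; \<tau> e \<noteq> None\<rbrakk> \<Longrightarrow> \<tau> f = \<tau> e"
    and "\<lbrakk>e \<in> idempotents; f \<in> idempotents; \<tau> e \<noteq> None; \<tau> f \<noteq> None\<rbrakk> \<Longrightarrow> \<tau> (e * f) \<noteq> None"
  using assms unfolding KS_tilde_def by blast+

text \<open>Monotonicity, that \<open>\<tau> e\<close> being finite forces \<open>\<tau> f = \<tau> e\<close> for \<open>e \<preceq> f\<close>, fails on an open
  set by \<open>openin_coordinate_mismatch\<close>. The failure of the condition on products \<open>e * f\<close> is not open by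
  itself, because \<open>\<infinity>\<close> need not be isolated, but together with monotonicity that condition
  strengthens to one with open failure: both conditions force all finite coordinates of \<open>\<tau>\<close> to be
  equal, so if \<open>\<tau> e\<close> and \<open>\<tau> f\<close> are finite and \<open>\<tau> (e * f) = \<infinity>\<close>, either \<open>\<tau> e\<close> and \<open>\<tau> f\<close> clash, or
  their common value is a point of \<open>X_e \<inter> X_f \<subseteq> X_{ef}\<close> from which \<open>\<tau> (e * f)\<close> differs.\<close>

lemma closedin_KS_tilde: "closedin (KS_product X \<theta>) (KS_tilde X \<theta>)"
proof -
  let ?P = "KS_product X \<theta>"
  have "\<exists>U. openin ?P U \<and> \<tau> \<in> U \<and> U \<subseteq> topspace ?P - KS_tilde X \<theta>"
    if \<tau>: "\<tau> \<in> topspace ?P - KS_tilde X \<theta>" for \<tau>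
  proof -
    have "(\<exists>e\<in>idempotents. \<exists>f\<in>idempotents. e \<preceq> f \<and> \<tau> e \<noteq> None \<and> \<tau> f \<noteq> \<tau> e) \<or>
        (\<exists>e\<in>idempotents. \<exists>f\<in>idempotents. \<tau> e \<noteq> None \<and> \<tau> f \<noteq> None \<and> \<tau> (e * f) = None)"
      using \<tau> by (auto simp: KS_tilde_def)
    then consider
      (mono) e f where "e \<in> idempotents" "f \<in> idempotents" "e \<preceq> f" "\<tau> e \<noteq> None" "\<tau> f \<noteq> \<tau> e"
    | (mult) e f where "e \<in> idempotents" "f \<in> idempotents" "\<tau> e \<noteq> None" "\<tau> f \<noteq> None"
        "\<tau> (e * f) = None"
      by blast
    then show ?thesis
    proof cases
      case mono
      let ?U = "{\<tau> \<in> topspace ?P. \<tau> e \<in> Some ` (fixed_set \<theta> e \<inter> fixed_set \<theta> f) \<and> \<tau> f \<noteq> \<tau> e}"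
      have "\<tau> \<in> ?U"
        using mono \<tau> coordinate_in_fixed_set[of \<tau> e] fixed_set_mono[of e f] by auto
      moreover have "\<sigma> f = \<sigma> e" if "\<sigma> \<in> KS_tilde X \<theta>" "\<sigma> e \<noteq> None" for \<sigma>
        using KS_tildeD(2)[OF that(1)] that(2) mono by blast
      then have "?U \<subseteq> topspace ?P - KS_tilde X \<theta>"
        by auto
      ultimately show ?thesis
        using openin_coordinate_mismatch mono by blast
    next
      case mult
      note ef = idempotents_mult_closed[OF mult(1,2)]
      have equal: "\<sigma> (e * f) = \<sigma> e \<and> \<sigma> f = \<sigma> e"
        if "\<sigma> \<in> KS_tilde X \<theta>" "\<sigma> e \<noteq> None" "\<sigma> f \<noteq> None" for \<sigma>
        using KS_tildeD(2)[OF that(1) ef mult(1) mult_natural_le1[OF mult(1,2)]]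
          KS_tildeD(2)[OF that(1) ef mult(2) mult_natural_le2[OF mult(1,2)]]
          KS_tildeD(3)[OF that(1) mult(1,2) that(2,3)] by simp
      show ?thesis
      proof (cases "\<tau> e = \<tau> f")
        case False
        let ?U = "{\<tau> \<in> topspace ?P. \<tau> e \<noteq> None \<and> \<tau> f \<noteq> None \<and> \<tau> e \<noteq> \<tau> f}"
        have "?U \<subseteq> topspace ?P - KS_tilde X \<theta>"
        proof
          fix \<sigma>
          assume \<sigma>: "\<sigma> \<in> ?U"
          then have "\<sigma> e \<noteq> None" "\<sigma> f \<noteq> None" "\<sigma> f \<noteq> \<sigma> e"
            by auto
          then have "\<sigma> \<notin> KS_tilde X \<theta>"
            using equal[of \<sigma>] by blast
          then show "\<sigma> \<in> topspace ?P - KS_tilde X \<theta>"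
            using \<sigma> by blast
        qed
        then show ?thesis
          using openin_finite_coordinates_clash[OF mult(1,2)] mult \<tau> False by blast
      next
        case True
        let ?U = "{\<tau> \<in> topspace ?P. \<tau> e \<in> Some ` (fixed_set \<theta> e \<inter> fixed_set \<theta> (e * f)) \<and>
              \<tau> (e * f) \<noteq> \<tau> e} \<inter> {\<tau> \<in> topspace ?P. \<tau> f \<noteq> None}"
        obtain x where x: "\<tau> e = Some x" "\<tau> f = Some x"
          using mult True by auto
        then have "x \<in> fixed_set \<theta> e \<inter> fixed_set \<theta> (e * f)"
          using \<tau> coordinate_in_fixed_set[OF _ mult(1)] coordinate_in_fixed_set[OF _ mult(2)]
            fixed_set_mult[of e f] by blast
        then have "\<tau> \<in> ?U"
          using x \<tau> mult by auto
        moreover have "?U \<subseteq> topspace ?P - KS_tilde X \<theta>"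
        proof
          fix \<sigma>
          assume \<sigma>: "\<sigma> \<in> ?U"
          then have "\<sigma> e \<noteq> None" "\<sigma> f \<noteq> None" "\<sigma> (e * f) \<noteq> \<sigma> e"
            by auto
          then have "\<sigma> \<notin> KS_tilde X \<theta>"
            using equal[of \<sigma>] by blast
          then show "\<sigma> \<in> topspace ?P - KS_tilde X \<theta>"
            using \<sigma> by blast
        qed
        moreover have "openin ?P ?U"
          by (intro openin_Int openin_coordinate_mismatch openin_finite_coordinate mult(1,2) ef)
        ultimately show ?thesis
          by blast
      qed
    qed
  qed
  then have "openin ?P (topspace ?P - KS_tilde X \<theta>)"
    by (subst openin_subopen) blast
  then show ?thesis
    using KS_tildeD(1) by (auto simp: closedin_def)
qed

section \<open>Boxes\<close>

definition admissible_pairs :: "('s \<times> 'x set) set" where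
  "admissible_pairs =
     {(f, K). f \<in> idempotents \<and> K \<subseteq> fixed_set \<theta> f \<and> compactin X K}"

definition KS_box :: "'s \<times> 'x set \<Rightarrow> ('s \<Rightarrow> 'x option) set" where
  "KS_box p = {\<tau> \<in> KS_tilde X \<theta>. \<tau> (fst p) \<in> Some ` snd p}"

lemma topspace_KS_space: "topspace (KS_space X \<theta>) = KS_tilde X \<theta> - {KS_infinity}"
  using KS_tildeD(1) by (auto simp: KS_space_def)

lemma compactin_KS_box:
  assumes "p \<in> admissible_pairs"
  shows "compactin (KS_space X \<theta>) (KS_box p)"
proof -
  obtain f K where p: "p = (f, K)" and f: "f \<in> idempotents"
    and K: "K \<subseteq> fixed_set \<theta> f" "compactin X K"
    using assms by (auto simp: admissible_pairs_def)
  let ?P = "KS_product X \<theta>"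
  let ?Xf = "subtopology X (fixed_set \<theta> f)"
  have "compactin ?Xf K"
    using K by (simp add: compactin_subtopology)
  then have "closedin (Alexandroff_compactification ?Xf) (Some ` K)"
    by (simp add: compactin_imp_closedin Hausdorff Hausdorff_space_subtopology)
  then have "closedin ?P {\<tau> \<in> topspace ?P. \<tau> f \<in> Some ` K}"
    by (rule closedin_continuous_map_preimage[OF continuous_coordinate[OF f]])
  then have "closedin ?P (KS_tilde X \<theta> \<inter> {\<tau> \<in> topspace ?P. \<tau> f \<in> Some ` K})"
    by (intro closedin_Int closedin_KS_tilde)
  moreover have "KS_tilde X \<theta> \<inter> {\<tau> \<in> topspace ?P. \<tau> f \<in> Some ` K} = KS_box p"
    using KS_tildeD(1) by (auto simp: KS_box_def p)
  ultimately have "compactin ?P (KS_box p)"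
    using compact_space_KS_product closedin_compact_space by metis
  moreover have "KS_box p \<subseteq> KS_tilde X \<theta> - {KS_infinity}"
    using f by (auto simp: KS_box_def p KS_infinity_def)
  ultimately show ?thesis
    by (simp add: KS_space_def compactin_subtopology)
qed

lemma finite_coordinate_exists:
  assumes "\<tau> \<in> topspace (KS_space X \<theta>)"
  obtains e x where "e \<in> idempotents" "\<tau> e = Some x"
proof -
  have "\<tau> \<in> extensional idempotents" "\<tau> \<noteq> KS_infinity"
    using assms KS_tildeD(1) by (auto simp: topspace_KS_space KS_product_def PiE_def)
  then have "\<exists>e\<in>idempotents. \<tau> e \<noteq> None"
    by (auto simp: KS_infinity_def intro!: extensionalityI)
  then show thesis
    using that by auto
qed

text \<open>Every point has a box neighbourhood, obtained from local compactness of \<open>X_f\<close> at a finite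
  coordinate \<open>\<tau> f\<close>.\<close>

lemma KS_box_neighbourhood:
  assumes "\<tau> \<in> topspace (KS_space X \<theta>)"
  obtains p W where "p \<in> admissible_pairs" "openin (KS_space X \<theta>) W" "\<tau> \<in> W" "W \<subseteq> KS_box p"
proof -
  obtain f x where f: "f \<in> idempotents" and x: "\<tau> f = Some x"
    using finite_coordinate_exists[OF assms] by blast
  let ?P = "KS_product X \<theta>"
  let ?Xf = "subtopology X (fixed_set \<theta> f)"
  have \<tau>: "\<tau> \<in> topspace ?P"
    using assms by (simp add: KS_space_def)
  have "x \<in> topspace ?Xf"
    using \<tau> f x coordinate_in_fixed_set topspace_fixed_set by metis
  moreover have "locally_compact_space ?Xf"
    using locally_compact_space_open_subset Hausdorff locally_compact openin_fixed_set f by blast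
  ultimately obtain U K where UK: "openin ?Xf U" "compactin ?Xf K" "x \<in> U" "U \<subseteq> K"
    unfolding locally_compact_space_def by blast
  have U: "openin X U" "U \<subseteq> fixed_set \<theta> f"
    using UK(1) openin_fixed_set[OF f] by (auto simp: openin_open_subtopology)
  let ?W = "{\<tau> \<in> topspace ?P. \<tau> f \<in> Some ` U} \<inter> (KS_tilde X \<theta> - {KS_infinity})"
  show thesis
  proof (rule that)
    show "(f, K) \<in> admissible_pairs"
      using UK(2) f by (simp add: admissible_pairs_def compactin_subtopology)
    show "openin (KS_space X \<theta>) ?W"
      unfolding KS_space_def openin_subtopology using openin_coordinate[OF f U] by blast
    show "\<tau> \<in> ?W"
      using assms \<tau> x UK(3) by (auto simp: topspace_KS_space)
    show "?W \<subseteq> KS_box (f, K)"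
      using UK(4) by (auto simp: KS_box_def)
  qed
qed

lemma compact_covered_by_boxes:
  assumes C: "compactin (KS_space X \<theta>) C"
  obtains F where "finite F" "F \<subseteq> admissible_pairs" "C \<subseteq> (\<Union>p\<in>F. KS_box p)"
proof -
  define \<W> where
    "\<W> = {W. openin (KS_space X \<theta>) W \<and> (\<exists>p\<in>admissible_pairs. W \<subseteq> KS_box p)}"
  have "C \<subseteq> \<Union>\<W>"
  proof
    fix \<tau>
    assume "\<tau> \<in> C"
    then have "\<tau> \<in> topspace (KS_space X \<theta>)"
      using compactin_subset_topspace[OF C] by blast
    then obtain p W where "p \<in> admissible_pairs" "openin (KS_space X \<theta>) W" "\<tau> \<in> W"
        "W \<subseteq> KS_box p"
      by (rule KS_box_neighbourhood)
    then show "\<tau> \<in> \<Union>\<W>"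
      by (auto simp: \<W>_def)
  qed
  moreover have "\<forall>W\<in>\<W>. openin (KS_space X \<theta>) W"
    by (simp add: \<W>_def)
  ultimately obtain \<V> where \<V>: "finite \<V>" "\<V> \<subseteq> \<W>" "C \<subseteq> \<Union>\<V>"
    using C unfolding compactin_def by meson
  have "\<forall>W\<in>\<V>. \<exists>p. p \<in> admissible_pairs \<and> W \<subseteq> KS_box p"
    using \<V>(2) unfolding \<W>_def by blast
  then obtain p where p: "\<forall>W\<in>\<V>. p W \<in> admissible_pairs \<and> W \<subseteq> KS_box (p W)"
    by (rule bchoice[THEN exE])
  show thesis
  proof (rule that)
    show "finite (p ` \<V>)" "p ` \<V> \<subseteq> admissible_pairs" "C \<subseteq> (\<Union>q\<in>p ` \<V>. KS_box q)"
      using \<V> p by blast+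
  qed
qed

section \<open>Principal points and covering families\<close>

text \<open>The point of \<open>X\<^sup>K\<^sup>S\<close> given by \<open>x\<close> and the filter of idempotents above \<open>e\<close>.\<close>

definition principal_point :: "'s \<Rightarrow> 'x \<Rightarrow> 's \<Rightarrow> 'x option" where
  "principal_point e x = (\<lambda>f\<in>idempotents. if e \<preceq> f then Some x else None)"

lemma principal_point_in_KS_space:
  assumes e: "e \<in> idempotents" and x: "x \<in> fixed_set \<theta> e"
  shows "principal_point e x \<in> topspace (KS_space X \<theta>)"
proof -
  have apply_eq: "principal_point e x f = (if e \<preceq> f then Some x else None)"
    if "f \<in> idempotents" for f
    using that by (simp add: principal_point_def)
  have "x \<in> fixed_set \<theta> f" if "e \<preceq> f" for f
    using that fixed_set_mono[OF e] x by blast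
  then have "principal_point e x \<in> topspace (KS_product X \<theta>)"
    using topspace_fixed_set by (auto simp: KS_product_def principal_point_def)
  moreover have "principal_point e x f' = principal_point e x f"
    if "f \<in> idempotents" "f' \<in> idempotents" "f \<preceq> f'" "principal_point e x f \<noteq> None" for f f'
    using that natural_le_trans[OF e that(1)] by (simp add: apply_eq split: if_splits)
  moreover have "principal_point e x (f * f') \<noteq> None"
    if "f \<in> idempotents" "f' \<in> idempotents" "principal_point e x f \<noteq> None"
      "principal_point e x f' \<noteq> None" for f f'
    using that natural_le_mult[OF e]
    by (simp add: apply_eq idempotents_mult_closed split: if_splits)
  ultimately have "principal_point e x \<in> KS_tilde X \<theta>"
    unfolding KS_tilde_def by blast
  moreover have "principal_point e x e \<noteq> KS_infinity e"
    by (simp add: apply_eq KS_infinity_def e natural_le_refl)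
  ultimately show ?thesis
    by (auto simp: topspace_KS_space)
qed

lemma principal_point_in_KS_box_iff:
  assumes "e \<in> idempotents" "x \<in> fixed_set \<theta> e" "f \<in> idempotents"
  shows "principal_point e x \<in> KS_box (f, K) \<longleftrightarrow> e \<preceq> f \<and> x \<in> K"
  using principal_point_in_KS_space[OF assms(1,2)] assms(3)
  by (auto simp: KS_box_def topspace_KS_space principal_point_def)

text \<open>If \<open>F\<close> covers and \<open>\<tau> e = x\<close> is finite, choose \<open>(f, K)\<close> in \<open>F\<close> with \<open>e \<preceq> f\<close> and \<open>x \<in> K\<close>;
  monotonicity of \<open>\<tau>\<close> gives \<open>\<tau> f = x\<close>. Conversely, test the boxes on the principal points.\<close>

lemma covering_family_iff:
  "covering_family X \<theta> F \<longleftrightarrow>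
     F \<subseteq> admissible_pairs \<and> topspace (KS_space X \<theta>) \<subseteq> (\<Union>p\<in>F. KS_box p)"
proof -
  have admissible: "(\<forall>(f, K)\<in>F. f \<in> idempotents \<and> K \<subseteq> fixed_set \<theta> f \<and> compactin X K) \<longleftrightarrow>
      F \<subseteq> admissible_pairs"
    by (auto simp: admissible_pairs_def)
  have "(\<forall>e\<in>idempotents. fixed_set \<theta> e \<subseteq> \<Union>{K. \<exists>f. (f, K) \<in> F \<and> e \<preceq> f}) \<longleftrightarrow>
      topspace (KS_space X \<theta>) \<subseteq> (\<Union>p\<in>F. KS_box p)" (is "?cover \<longleftrightarrow> _")
    if F: "F \<subseteq> admissible_pairs"
  proof
    assume cover: ?cover
    show "topspace (KS_space X \<theta>) \<subseteq> (\<Union>p\<in>F. KS_box p)"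
    proof
      fix \<tau>
      assume \<tau>: "\<tau> \<in> topspace (KS_space X \<theta>)"
      then obtain e x where e: "e \<in> idempotents" "\<tau> e = Some x"
        by (rule finite_coordinate_exists)
      have tilde: "\<tau> \<in> KS_tilde X \<theta>"
        using \<tau> by (simp add: topspace_KS_space)
      have "x \<in> fixed_set \<theta> e"
        using coordinate_in_fixed_set[OF KS_tildeD(1)[OF tilde] e] .
      then obtain f K where fK: "(f, K) \<in> F" "e \<preceq> f" "x \<in> K"
        using cover e(1) by blast
      then have "f \<in> idempotents"
        using F by (auto simp: admissible_pairs_def)
      then have "\<tau> f = Some x"
        using KS_tildeD(2)[OF tilde e(1) _ fK(2)] e(2) by simp
      then have "\<tau> \<in> KS_box (f, K)"
        using tilde fK(3) by (simp add: KS_box_def)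
      then show "\<tau> \<in> (\<Union>p\<in>F. KS_box p)"
        using fK(1) by blast
    qed
  next
    assume boxes: "topspace (KS_space X \<theta>) \<subseteq> (\<Union>p\<in>F. KS_box p)"
    show ?cover
    proof (intro ballI subsetI)
      fix e x
      assume ex: "e \<in> idempotents" "x \<in> fixed_set \<theta> e"
      obtain f K where fK: "(f, K) \<in> F" "principal_point e x \<in> KS_box (f, K)"
        using boxes principal_point_in_KS_space[OF ex] by auto
      moreover have "f \<in> idempotents"
        using F fK(1) by (auto simp: admissible_pairs_def)
      ultimately show "x \<in> \<Union>{K. \<exists>f. (f, K) \<in> F \<and> e \<preceq> f}"
        using principal_point_in_KS_box_iff[OF ex] by blast
    qed
  qed
  then show ?thesis
    unfolding covering_family_def admissible by blast
qed

lemma covering_family_Union: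
  assumes "covering_family X \<theta> F"
  shows "(\<Union>p\<in>F. KS_box p) = topspace (KS_space X \<theta>)"
    and "\<And>p. p \<in> F \<Longrightarrow> compactin (KS_space X \<theta>) (KS_box p)"
proof -
  show compact: "compactin (KS_space X \<theta>) (KS_box p)" if "p \<in> F" for p
    using that assms unfolding covering_family_iff by (blast intro: compactin_KS_box)
  show "(\<Union>p\<in>F. KS_box p) = topspace (KS_space X \<theta>)"
    using assms compactin_subset_topspace[OF compact] by (fastforce simp: covering_family_iff)
qed

theorem finite_covering_family_iff_compact:
  "(\<exists>F. finite F \<and> covering_family X \<theta> F) \<longleftrightarrow> compact_space (KS_space X \<theta>)"
proof
  assume "\<exists>F. finite F \<and> covering_family X \<theta> F"
  then obtain F where F: "finite F" "covering_family X \<theta> F"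
    by blast
  have "compactin (KS_space X \<theta>) (\<Union>p\<in>F. KS_box p)"
    using F(1) covering_family_Union(2)[OF F(2)] by (intro compactin_Union) auto
  then show "compact_space (KS_space X \<theta>)"
    by (simp add: compact_space_def covering_family_Union(1)[OF F(2)])
next
  assume "compact_space (KS_space X \<theta>)"
  then obtain F where "finite F" "F \<subseteq> admissible_pairs"
      "topspace (KS_space X \<theta>) \<subseteq> (\<Union>p\<in>F. KS_box p)"
    unfolding compact_space_def by (rule compact_covered_by_boxes)
  then show "\<exists>F. finite F \<and> covering_family X \<theta> F"
    using covering_family_iff by blast
qed

theorem countable_covering_family_iff_sigma_compact:
  "(\<exists>F. countable F \<and> covering_family X \<theta> F) \<longleftrightarrow> sigma_compact_space (KS_space X \<theta>)"
proof
  assume "\<exists>F. countable F \<and> covering_family X \<theta> F"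
  then obtain F where F: "countable F" "covering_family X \<theta> F"
    by blast
  then have "countable (KS_box ` F)" "\<forall>C\<in>KS_box ` F. compactin (KS_space X \<theta>) C"
      "\<Union>(KS_box ` F) = topspace (KS_space X \<theta>)"
    using covering_family_Union[OF F(2)] by auto
  then show "sigma_compact_space (KS_space X \<theta>)"
    unfolding sigma_compact_space_def by blast
next
  assume "sigma_compact_space (KS_space X \<theta>)"
  then obtain \<K> where \<K>: "countable \<K>" "\<forall>C\<in>\<K>. compactin (KS_space X \<theta>) C"
      "\<Union>\<K> = topspace (KS_space X \<theta>)"
    unfolding sigma_compact_space_def by (elim exE conjE)
  have "\<forall>C\<in>\<K>. \<exists>F. finite F \<and> F \<subseteq> admissible_pairs \<and> C \<subseteq> (\<Union>p\<in>F. KS_box p)"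
  proof
    fix C
    assume "C \<in> \<K>"
    then have "compactin (KS_space X \<theta>) C"
      using \<K>(2) by blast
    then show "\<exists>F. finite F \<and> F \<subseteq> admissible_pairs \<and> C \<subseteq> (\<Union>p\<in>F. KS_box p)"
      by (rule compact_covered_by_boxes) (intro exI conjI)
  qed
  then obtain F where F: "\<forall>C\<in>\<K>. finite (F C) \<and> F C \<subseteq> admissible_pairs \<and>
      C \<subseteq> (\<Union>p\<in>F C. KS_box p)"
    by (rule bchoice[THEN exE])
  have "countable (\<Union>C\<in>\<K>. F C)"
    using \<K>(1) F by (intro countable_UN) (auto intro: countable_finite)
  moreover have "topspace (KS_space X \<theta>) \<subseteq> (\<Union>p\<in>(\<Union>C\<in>\<K>. F C). KS_box p)"
    unfolding \<K>(3)[symmetric] using F by blast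
  moreover have "(\<Union>C\<in>\<K>. F C) \<subseteq> admissible_pairs"
    using F by blast
  ultimately show "\<exists>F. countable F \<and> covering_family X \<theta> F"
    using covering_family_iff by blast
qed

end

theorem theorem3p1p9:
  fixes X :: "'x topology" and \<theta> :: "'s::inverse_semigroup \<Rightarrow> 'x \<rightharpoonup> 'x"
  assumes "locally_compact_space X" and "Hausdorff_space X"
    and "inverse_semigroup_action X \<theta>"
  shows "((\<exists>F. finite F \<and> covering_family X \<theta> F) \<longleftrightarrow> compact_space (KS_space X \<theta>)) \<and>
         ((\<exists>F. countable F \<and> covering_family X \<theta> F) \<longleftrightarrow> sigma_compact_space (KS_space X \<theta>))"
proof -
  interpret locally_compact_action X \<theta>
    by unfold_locales (fact assms)+
  show ?thesis
    using finite_covering_family_iff_compact countable_covering_family_iff_sigma_compact by blast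
qed

end
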